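(* Let $m\in\mathbb N$, $p\ge1$, $\theta>0$, let $\|\cdot\|=\|\cdot\|_2$ be the Euclidean norm on $\mathbb R^m$, let $\mathbb P'\in\mathcal P_p(\mathbb R^m)$ and $\mathbf 0\ne\mathbf c\in\mathbb R^m$. Then $$\sup_{\mathbb P\in\mathbb B_{\theta,p}(\mathbb P')}\mathbb E_{\mathbb P}[\mathbf c^\top\tilde{\boldsymbol\xi}]=\mathbf c^\top\mathbb E_{\mathbb P'}[\tilde{\boldsymbol\xi}']+\theta\|\mathbf c\|_2,$$ and a worst-case distribution (i.e. an element of $\mathbb B_{\theta,p}(\mathbb P')$ attaining the supremum) is given by the push-forward $\mathbb P^*=T_{\#}\mathbb P'$ with $T(\mathbf z)=\mathbf z+\frac{\theta}{\|\mathbf c\|_2}\,\mathbf c$.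
   Context: $\mathcal P(\mathbb R^m)$ is the set of Borel probability measures on $\mathbb R^m$ and $\mathcal P_p(\mathbb R^m)$ the subset of those with finite $p$-th moment $\mathbb E_{\mathbb P}[\|\tilde{\boldsymbol\xi}\|^p]<\infty$. $\mathbb E_{\mathbb P}$ denotes expectation when the random vector $\tilde{\boldsymbol\xi}$ has law $\mathbb P$ (and $\tilde{\boldsymbol\xi}'$ has law $\mathbb P'$). The $p$-Wasserstein distance is $W_p(\mathbb P,\mathbb P')=\big(\inf_{\pi\in\Pi(\mathbb P,\mathbb P')}\int\|\boldsymbol\xi-\boldsymbol\xi'\|^p\,\mathrm d\pi\big)^{1/p}$, where $\Pi(\mathbb P,\mathbb P')$ is the set of couplings, and $\mathbb B_{\theta,p}(\mathbb P')=\{\mathbb P\in\mathcal P(\mathbb R^m):W_p(\mathbb P,\mathbb P')\le\theta\}$. *)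

theory Defs
  imports "HOL-Probability.Probability"
begin

definition borel_probs :: "'a::euclidean_space measure set" where
  "borel_probs = {P. prob_space P \<and> sets P = sets borel}"

definition borel_probs_moment :: "real \<Rightarrow> 'a::euclidean_space measure set" where
  "borel_probs_moment p =
     {P \<in> borel_probs. (\<integral>\<^sup>+ x. ennreal (norm x powr p) \<partial>P) < \<infinity>}"

definition couplings ::
  "'a::euclidean_space measure \<Rightarrow> 'a measure \<Rightarrow> ('a \<times> 'a) measure set" where
  "couplings P P' =
     {\<pi>. prob_space \<pi> \<and> sets \<pi> = sets (borel \<Otimes>\<^sub>M borel) \<and>
          distr \<pi> borel fst = P \<and> distr \<pi> borel snd = P'}"

definition transport_cost ::
  "real \<Rightarrow> 'a::euclidean_space measure \<Rightarrow> 'a measure \<Rightarrow> ennreal" where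
  "transport_cost p P P' =
     (INF \<pi>\<in>couplings P P'. \<integral>\<^sup>+ (x, y). ennreal (norm (x - y) powr p) \<partial>\<pi>)"

text \<open>The distance takes values in the extended nonnegative reals: the infimal transport
  cost may be infinite, and \<open>powr\<close> is not available on \<^typ>\<open>ennreal\<close>.\<close>

definition wasserstein ::
  "real \<Rightarrow> 'a::euclidean_space measure \<Rightarrow> 'a measure \<Rightarrow> ennreal" where
  "wasserstein p P P' =
     (if transport_cost p P P' = \<infinity> then \<infinity>
      else ennreal (enn2real (transport_cost p P P') powr (1 / p)))"

definition wasserstein_ball ::
  "real \<Rightarrow> real \<Rightarrow> 'a::euclidean_space measure \<Rightarrow> 'a measure set" where
  "wasserstein_ball \<theta> p P' = {P \<in> borel_probs. wasserstein p P P' \<le> ennreal \<theta>}"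

end

theory Submission
  imports Defs
begin

text \<open>
  Let \<open>\<pi>\<close> couple \<open>P\<close> with \<open>P'\<close>. The two means differ by \<open>\<integral>(x - y) d\<pi>\<close>, so by Cauchy-Schwarz
  the values of the linear functional differ by at most \<open>norm c\<close> times the expected displacement
  \<open>\<integral>norm (x - y) d\<pi>\<close>. The constraint, however, bounds the \<open>p\<close>-th moment of the displacement.
  Passing from one to the other is usually Jensen's inequality for \<open>t \<mapsto> t\<^sup>p\<close>; here it is done
  pointwise, with the single tangent of that convex function at \<open>t = \<theta>\<close>
  (lemma \<open>powr_tangent_bound\<close>). A coupling of cost \<open>\<theta>\<^sup>p\<close> thereby gets an expected displacement
  of at most \<open>\<theta>\<close>, and a coupling of cost \<open>\<theta>\<^sup>p + \<epsilon>\<close> exceeds this by at most a fixed multiple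
  of \<open>\<epsilon>\<close> (lemma \<open>coupling_gap_bound\<close>). A measure in the ball comes with couplings whose cost is
  arbitrarily close to \<open>\<theta>\<^sup>p\<close> or below it, so letting \<open>\<epsilon>\<close> tend to zero takes the place of the
  existence of optimal couplings (lemma \<open>wasserstein_ball_mean_bound\<close>). The tangent at \<open>1\<close>
  shows that a finite \<open>p\<close>-th moment implies integrability.

  The bound is attained by moving all mass by one fixed vector of length \<open>\<theta>\<close> in the direction
  of \<open>c\<close>: the displacement is then constant, which makes the tangent bound sharp, and parallel
  to \<open>c\<close>, which makes Cauchy-Schwarz sharp. The coupling of each point with its translate shows
  that this measure lies in the ball (lemma \<open>translation_in_wasserstein_ball\<close>).
\<close>

text \<open>By convexity the graph of \<open>t \<mapsto> t powr p\<close> lies above its tangent at \<open>s\<close>, here solved for \<open>t\<close>.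
  After multiplication by \<open>s powr (p - 1)\<close> it becomes the weighted inequality between geometric
  and arithmetic mean of \<open>t powr p\<close> and \<open>s powr p\<close>, with weights \<open>1 / p\<close> and \<open>1 - 1 / p\<close>.\<close>

lemma powr_tangent_bound:
  fixes t s p :: real
  assumes "p \<ge> 1" "s > 0" "t \<ge> 0"
  shows "t \<le> s + (t powr p - s powr p) / (p * s powr (p - 1))"
proof -
  have s: "s powr p = s * s powr (p - 1)"
    using assms(2) by (simp add: powr_diff)
  have pos: "p * s powr (p - 1) > 0"
    using assms by simp
  have "t * s powr (p - 1) \<le> 1 / p * t powr p + (1 - 1 / p) * s powr p"
  proof (cases "t = 0")
    case True
    then show ?thesis using assms by simp
  next
    case False
    have "(t powr p) powr (1 / p) * (s powr p) powr (1 - 1 / p)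
        \<le> 1 / p * t powr p + (1 - 1 / p) * s powr p"
      using assms False by (intro Youngs_inequality_0) auto
    moreover have "(t powr p) powr (1 / p) = t"
      using assms by (simp add: powr_powr)
    moreover have "(s powr p) powr (1 - 1 / p) = s powr (p - 1)"
      using assms by (simp add: powr_powr right_diff_distrib)
    ultimately show ?thesis
      by simp
  qed
  then have "p * (t * s powr (p - 1)) \<le> p * (1 / p * t powr p + (1 - 1 / p) * s powr p)"
    using assms(1) by (intro mult_left_mono) auto
  also have "\<dots> = t powr p + (p - 1) * s powr p"
    using assms(1) by (simp add: field_simps)
  finally have "p * s powr (p - 1) * (t - s) \<le> t powr p - s powr p"
    using s by (simp add: algebra_simps)
  then show ?thesis
    using pos_le_divide_eq[OF pos, of "t - s" "t powr p - s powr p"] by (simp add: mult.commute)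
qed

lemma couplingD:
  fixes P P' :: "'a::euclidean_space measure"
  assumes "\<pi> \<in> couplings P P'"
  shows "distr \<pi> borel fst = P" "distr \<pi> borel snd = P'" "prob_space \<pi>"
    and "fst \<in> borel_measurable \<pi>" "snd \<in> borel_measurable \<pi>"
proof -
  show "distr \<pi> borel fst = P" "distr \<pi> borel snd = P'" "prob_space \<pi>"
    using assms by (auto simp: couplings_def)
  have [measurable_cong]: "sets \<pi> = sets (borel \<Otimes>\<^sub>M borel)"
    using assms by (auto simp: couplings_def)
  show "fst \<in> borel_measurable \<pi>" "snd \<in> borel_measurable \<pi>"
    by measurable
qed

lemma integrable_of_finite_moment:
  fixes f :: "'a \<Rightarrow> 'b::euclidean_space"
  assumes "prob_space M" "p \<ge> 1" and [measurable]: "f \<in> borel_measurable M"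
    and fin: "(\<integral>\<^sup>+ x. ennreal (norm (f x) powr p) \<partial>M) < \<infinity>"
  shows "integrable M (\<lambda>x. norm (f x) powr p)" "integrable M f"
proof -
  interpret prob_space M by fact
  show moment: "integrable M (\<lambda>x. norm (f x) powr p)"
    using fin by (intro integrableI_bounded) auto
  \<comment> \<open>The tangent at 1 dominates \<open>norm (f x)\<close> by an affine function of its \<open>p\<close>-th power.\<close>
  have "norm (f x) \<le> norm (1 + (norm (f x) powr p - 1) / p)" for x
    using powr_tangent_bound[of p 1 "norm (f x)"] assms(2) by auto
  then show "integrable M f"
    using moment by (intro Bochner_Integration.integrable_bound[of M "\<lambda>x. 1 + (norm (f x) powr p - 1) / p" f]) auto
qed

lemma transport_cost_le_of_wasserstein_le:
  assumes "p \<ge> 1" "\<theta> \<ge> 0" "wasserstein p P P' \<le> ennreal \<theta>"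
  shows "transport_cost p P P' \<le> ennreal (\<theta> powr p)"
proof -
  have fin: "transport_cost p P P' \<noteq> \<infinity>"
    using assms(3) by (auto simp: wasserstein_def top_unique split: if_splits)
  then obtain r where r: "r \<ge> 0" "transport_cost p P P' = ennreal r"
    by (cases "transport_cost p P P'") auto
  have "r powr (1 / p) \<le> \<theta>"
    using assms(2,3) r by (auto simp: wasserstein_def)
  then have "(r powr (1 / p)) powr p \<le> \<theta> powr p"
    using assms by (intro powr_mono2) auto
  then show ?thesis
    using r assms by (simp add: powr_powr ennreal_leI)
qed

lemma wasserstein_le_of_coupling:
  assumes "p \<ge> 1" "\<theta> \<ge> 0" "\<pi> \<in> couplings P P'"
    and "(\<integral>\<^sup>+ (x, y). ennreal (norm (x - y) powr p) \<partial>\<pi>) \<le> ennreal (\<theta> powr p)"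
  shows "wasserstein p P P' \<le> ennreal \<theta>"
proof -
  have le: "transport_cost p P P' \<le> ennreal (\<theta> powr p)"
    unfolding transport_cost_def using assms(3,4) by (rule INF_lower2)
  then obtain r where r: "r \<ge> 0" "transport_cost p P P' = ennreal r"
    by (cases "transport_cost p P P'") (auto simp: top_unique)
  then have "r \<le> \<theta> powr p"
    using le by (simp add: ennreal_le_iff)
  then have "r powr (1 / p) \<le> (\<theta> powr p) powr (1 / p)"
    using assms r by (intro powr_mono2) auto
  then show ?thesis
    using r assms by (simp add: wasserstein_def powr_powr ennreal_leI)
qed

text \<open>The expected displacement is estimated by integrating the tangent bound at \<open>\<theta>\<close>, whose slope
  \<open>p * \<theta> powr (p - 1)\<close> converts the excess cost \<open>\<epsilon>\<close> into excess displacement. Integrability of the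
  first marginal comes along, since its points are those of the second marginal plus a
  displacement with finite \<open>p\<close>-th moment.\<close>

lemma coupling_gap_bound:
  fixes P P' :: "'a::euclidean_space measure"
  assumes "p \<ge> 1" "\<theta> > 0" "\<epsilon> > 0" and coupling: "\<pi> \<in> couplings P P'"
    and cost: "(\<integral>\<^sup>+ (x, y). ennreal (norm (x - y) powr p) \<partial>\<pi>) \<le> ennreal (\<theta> powr p + \<epsilon>)"
    and mean: "integrable P' (\<lambda>x. x)"
  shows "integrable P (\<lambda>x. x)"
    and "c \<bullet> (\<integral>x. x \<partial>P)
      \<le> c \<bullet> (\<integral>x. x \<partial>P') + norm c * (\<theta> + \<epsilon> / (p * \<theta> powr (p - 1)))"
proof -
  note [measurable] = couplingD(4,5)[OF coupling]
  note P = couplingD(1)[OF coupling, symmetric]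
  note P' = couplingD(2)[OF coupling, symmetric]
  interpret prob_space \<pi> by (rule couplingD(3)[OF coupling])
  define k where "k = p * \<theta> powr (p - 1)"
  have k: "k > 0" using assms by (simp add: k_def)
  let ?d = "\<lambda>z. fst z - snd z"
  have cost': "(\<integral>\<^sup>+ z. ennreal (norm (?d z) powr p) \<partial>\<pi>) \<le> ennreal (\<theta> powr p + \<epsilon>)"
    using cost by (simp add: case_prod_unfold)
  then have "(\<integral>\<^sup>+ z. ennreal (norm (?d z) powr p) \<partial>\<pi>) < \<infinity>"
    by (auto intro: le_less_trans)
  then have pw: "integrable \<pi> (\<lambda>z. norm (?d z) powr p)" and d: "integrable \<pi> ?d"
    by (intro integrable_of_finite_moment[OF prob_space_axioms assms(1)]; simp)+
  have s: "integrable \<pi> snd"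
    using mean unfolding P' by (simp add: integrable_distr_eq)
  have f: "integrable \<pi> fst"
    using Bochner_Integration.integrable_add[OF d s] by simp
  show "integrable P (\<lambda>x. x)"
    unfolding P using f by (simp add: integrable_distr_eq)
  have int_cost: "(\<integral>z. norm (?d z) powr p \<partial>\<pi>) \<le> \<theta> powr p + \<epsilon>"
    using cost' pw assms(3) by (simp add: nn_integral_eq_integral ennreal_le_iff del: ennreal_plus)
  have "c \<bullet> (\<integral>x. x \<partial>P) - c \<bullet> (\<integral>x. x \<partial>P') = c \<bullet> (\<integral>z. ?d z \<partial>\<pi>)"
    unfolding P P' using f s by (simp add: integral_distr inner_diff_right)
  also have "\<dots> \<le> norm c * norm (\<integral>z. ?d z \<partial>\<pi>)"
    by (rule norm_cauchy_schwarz)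
  finally have gap: "c \<bullet> (\<integral>x. x \<partial>P) - c \<bullet> (\<integral>x. x \<partial>P') \<le> norm c * norm (\<integral>z. ?d z \<partial>\<pi>)" .
  have "norm (\<integral>z. ?d z \<partial>\<pi>) \<le> (\<integral>z. norm (?d z) \<partial>\<pi>)"
    by (rule integral_norm_bound)
  also have "\<dots> \<le> (\<integral>z. \<theta> + (norm (?d z) powr p - \<theta> powr p) / k \<partial>\<pi>)"
    unfolding k_def using integrable_norm[OF d] pw assms(1,2)
    by (intro integral_mono powr_tangent_bound Bochner_Integration.integrable_add
        integrable_divide Bochner_Integration.integrable_diff) auto
  also have "\<dots> = \<theta> + ((\<integral>z. norm (?d z) powr p \<partial>\<pi>) - \<theta> powr p) / k"
    using pw by (simp add: prob_space)
  also have "\<dots> \<le> \<theta> + \<epsilon> / k"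
    using int_cost k by (simp add: divide_right_mono)
  finally have "norm (\<integral>z. ?d z \<partial>\<pi>) \<le> \<theta> + \<epsilon> / k" .
  then have "norm c * norm (\<integral>z. ?d z \<partial>\<pi>) \<le> norm c * (\<theta> + \<epsilon> / k)"
    by (intro mult_left_mono) auto
  then show "c \<bullet> (\<integral>x. x \<partial>P) \<le> c \<bullet> (\<integral>x. x \<partial>P') + norm c * (\<theta> + \<epsilon> / (p * \<theta> powr (p - 1)))"
    using gap unfolding k_def by linarith
qed

text \<open>The transport cost is an infimum, so for each \<open>\<epsilon> > 0\<close> some coupling costs at most
  \<open>\<theta> powr p + \<epsilon>\<close>, and the error in the previous bound vanishes with \<open>\<epsilon>\<close>.\<close>

lemma wasserstein_ball_mean_bound:
  fixes P P' :: "'a::euclidean_space measure"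
  assumes "p \<ge> 1" "\<theta> > 0" "integrable P' (\<lambda>x. x)" "P \<in> wasserstein_ball \<theta> p P'"
  shows "integrable P (\<lambda>x. x)"
    and "c \<bullet> (\<integral>x. x \<partial>P) \<le> c \<bullet> (\<integral>x. x \<partial>P') + \<theta> * norm c"
proof -
  have tc: "transport_cost p P P' \<le> ennreal (\<theta> powr p)"
    using assms by (intro transport_cost_le_of_wasserstein_le) (auto simp: wasserstein_ball_def)
  have near: "\<exists>\<pi>\<in>couplings P P'. (\<integral>\<^sup>+ (x, y). ennreal (norm (x - y) powr p) \<partial>\<pi>) \<le> ennreal (\<theta> powr p + \<epsilon>)"
    if "\<epsilon> > 0" for \<epsilon>
  proof -
    have "transport_cost p P P' < ennreal (\<theta> powr p + \<epsilon>)"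
      using that by (intro le_less_trans[OF tc]) (simp add: ennreal_less_iff)
    then show ?thesis
      unfolding transport_cost_def INF_less_iff by (meson less_imp_le)
  qed
  show "integrable P (\<lambda>x. x)"
    using near[of 1] coupling_gap_bound(1)[OF assms(1,2) zero_less_one _ _ assms(3)] by auto
  show "c \<bullet> (\<integral>x. x \<partial>P) \<le> c \<bullet> (\<integral>x. x \<partial>P') + \<theta> * norm c"
  proof (rule field_le_epsilon)
    fix e :: real assume e: "e > 0"
    \<comment> \<open>The error term is \<open>norm c * \<epsilon> / (p * \<theta> powr (p - 1))\<close>; this \<open>\<epsilon>\<close> keeps it below \<open>e\<close>,
      and adding 1 to \<open>norm c\<close> keeps the division meaningful for \<open>c = 0\<close>.\<close>
    define \<epsilon> where "\<epsilon> = e / (norm c + 1) * (p * \<theta> powr (p - 1))"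
    have k: "p * \<theta> powr (p - 1) > 0" using assms by simp
    have n: "norm c + 1 > 0" by (simp add: add_nonneg_pos)
    have "\<epsilon> > 0" unfolding \<epsilon>_def using e k n by (intro mult_pos_pos[OF _ k] divide_pos_pos)
    then obtain \<pi> where "\<pi> \<in> couplings P P'"
      "(\<integral>\<^sup>+ (x, y). ennreal (norm (x - y) powr p) \<partial>\<pi>) \<le> ennreal (\<theta> powr p + \<epsilon>)"
      using near by blast
    from coupling_gap_bound(2)[OF assms(1,2) \<open>\<epsilon> > 0\<close> this assms(3), of c]
    have "c \<bullet> (\<integral>x. x \<partial>P) \<le> c \<bullet> (\<integral>x. x \<partial>P') + norm c * (\<theta> + e / (norm c + 1))"
      using k assms by (simp add: \<epsilon>_def)
    moreover have "norm c * (e / (norm c + 1)) \<le> e"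
      using e n by (simp add: field_simps)
    ultimately show "c \<bullet> (\<integral>x. x \<partial>P) \<le> c \<bullet> (\<integral>x. x \<partial>P') + \<theta> * norm c + e"
      by (simp add: algebra_simps)
  qed
qed

text \<open>The coupling that pairs each point with its own translate has the constant displacement \<open>v\<close>.\<close>

lemma translation_in_wasserstein_ball:
  fixes P' :: "'a::euclidean_space measure"
  assumes "p \<ge> 1" "P' \<in> borel_probs" "norm v \<le> \<theta>"
  shows "distr P' borel (\<lambda>z. z + v) \<in> wasserstein_ball \<theta> p P'"
proof -
  have sets[measurable_cong]: "sets P' = sets borel" and "prob_space P'"
    using assms(2) by (auto simp: borel_probs_def)
  interpret prob_space P' by fact
  have \<theta>: "\<theta> \<ge> 0" using assms(3) norm_ge_zero order_trans by blast
  let ?P = "distr P' borel (\<lambda>z. z + v)"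
  let ?\<pi> = "distr P' (borel \<Otimes>\<^sub>M borel) (\<lambda>z. (z + v, z))"
  have "distr P' borel (\<lambda>z. z) = P'"
    by (rule distr_id2) (simp add: sets)
  then have "?\<pi> \<in> couplings ?P P'"
    unfolding couplings_def by (auto intro!: prob_space_distr simp: distr_distr comp_def)
  moreover have "(\<integral>\<^sup>+ (x, y). ennreal (norm (x - y) powr p) \<partial>?\<pi>) \<le> ennreal (\<theta> powr p)"
    using assms by (simp add: nn_integral_distr emeasure_space_1 ennreal_leI powr_mono2)
  ultimately have "wasserstein p ?P P' \<le> ennreal \<theta>"
    using assms(1) \<theta> by (intro wasserstein_le_of_coupling)
  moreover have "?P \<in> borel_probs"
    by (auto simp: borel_probs_def intro!: prob_space_distr)
  ultimately show ?thesis
    by (simp add: wasserstein_ball_def)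
qed

theorem theorem2p10:
  fixes p \<theta> :: real and P' :: "(real ^ 'm) measure" and c :: "real ^ 'm"
  assumes "p \<ge> 1" and "\<theta> > 0"
    and "P' \<in> borel_probs_moment p"
    and "c \<noteq> 0"
  shows "integrable P' (\<lambda>x. x) \<and>
    (\<forall>P \<in> wasserstein_ball \<theta> p P'. integrable P (\<lambda>x. c \<bullet> x)) \<and>
    (SUP P \<in> wasserstein_ball \<theta> p P'. ereal (\<integral>x. c \<bullet> x \<partial>P))
      = ereal (c \<bullet> (\<integral>x. x \<partial>P') + \<theta> * norm c) \<and>
    (let P_star = distr P' borel (\<lambda>z. z + (\<theta> / norm c) *\<^sub>R c) in
      P_star \<in> wasserstein_ball \<theta> p P' \<and>
      ereal (\<integral>x. c \<bullet> x \<partial>P_star)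
        = (SUP P \<in> wasserstein_ball \<theta> p P'. ereal (\<integral>x. c \<bullet> x \<partial>P)))"
proof -
  have [measurable_cong]: "sets P' = sets borel" and "prob_space P'" and P': "P' \<in> borel_probs"
    and moment: "(\<integral>\<^sup>+ x. ennreal (norm x powr p) \<partial>P') < \<infinity>"
    using assms(3) by (auto simp: borel_probs_moment_def borel_probs_def)
  interpret prob_space P' by fact
  let ?B = "wasserstein_ball \<theta> p P'"
  let ?v = "(\<theta> / norm c) *\<^sub>R c"
  let ?Q = "distr P' borel (\<lambda>z. z + ?v)"
  let ?val = "c \<bullet> (\<integral>x. x \<partial>P') + \<theta> * norm c"
  have mean: "integrable P' (\<lambda>x. x)"
    by (rule integrable_of_finite_moment(2)[OF \<open>prob_space P'\<close> assms(1) _ moment]) simp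
  have int: "integrable P (\<lambda>x. x)" if "P \<in> ?B" for P
    using wasserstein_ball_mean_bound(1)[OF assms(1,2) mean that] .
  have upper: "(\<integral>x. c \<bullet> x \<partial>P) \<le> ?val" if "P \<in> ?B" for P
    using wasserstein_ball_mean_bound(2)[OF assms(1,2) mean that] int[OF that] by simp
  have Q: "?Q \<in> ?B"
    using assms by (intro translation_in_wasserstein_ball P') auto
  have "(\<integral>x. c \<bullet> x \<partial>?Q) = (\<integral>z. c \<bullet> z + c \<bullet> ?v \<partial>P')"
    by (simp add: integral_distr inner_add_right)
  also have "\<dots> = c \<bullet> (\<integral>x. x \<partial>P') + c \<bullet> ?v"
    using mean by (simp add: prob_space)
  also have "c \<bullet> ?v = \<theta> * norm c"
    using assms(4) by (simp add: dot_square_norm power2_eq_square)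
  finally have attained: "(\<integral>x. c \<bullet> x \<partial>?Q) = ?val" .
  have "(SUP P \<in> ?B. ereal (\<integral>x. c \<bullet> x \<partial>P)) = ereal ?val"
  proof (rule antisym)
    show "(SUP P \<in> ?B. ereal (\<integral>x. c \<bullet> x \<partial>P)) \<le> ereal ?val"
      using upper by (intro SUP_least) simp
    show "ereal ?val \<le> (SUP P \<in> ?B. ereal (\<integral>x. c \<bullet> x \<partial>P))"
      using Q by (rule SUP_upper2) (simp only: attained)
  qed
  then show ?thesis
    unfolding Let_def using mean int Q by (auto simp: attained)
qed

end
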